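(* Let $\omega=(\eta,t)\in\Omega^*$. The following are equivalent: (i) $\nu_\omega$ has the additive property and the free ultrafilter $[2^\omega]$ contains a set $\{m_k\}_{k=1}^\infty$ (with $m_1<m_2<\cdots$) such that $\lim_{k\to\infty}m_{k+1}/m_k=\infty$; (ii) $\omega\in\mathcal{W}$.
   Context: $\eta\text{-}\lim_n a_n$ is the limit of a bounded sequence along an ultrafilter $\eta$ on $\mathbb{N}$. $\mathbb{N}^*$ is the set of free ultrafilters on $\mathbb{N}$ (remainder of $\beta\mathbb{N}$), $\tau$ the continuous extension to $\beta\mathbb{N}$ of $n\mapsto n+1$. $\Omega$ is the quotient of $\beta\mathbb{N}\times[0,1]$ identifying $(\eta,1)$ with $(\tau\eta,0)$; $\Omega^*$ the closed subspace of classes $(\eta,t)$ with $\eta\in\mathbb{N}^*$; the flow is $\tau^s(\eta,t)=(\tau^{[t+s]}\eta,t+s-[t+s])$, $s\in\mathbb{R}$, $[x]$ the integer part. $\mathcal{W}$ (wandering points) is the set of $\omega\in\Omega^*$ for which there are an open neighbourhood $U$ of $\omega$ and an open neighbourhood $V$ of $0\in\mathbb{R}$ with $U\cap\tau^sU=\emptyset$ for every $s\in\mathbb{R}\setminus V$. For $\omega=(\eta,t)$, $\theta=2^t$: $[2^\omega]=\{S\subseteq\mathbb{N}:\{n\in\mathbb{N}:[\theta2^n]\in S\}\in\eta\}$, and $\nu_\omega(A)=\eta\text{-}\lim_n\frac{|A\cap[1,[\theta2^n]]|}{\theta 2^n}$ for $A\subseteq\mathbb{N}$. A finitely additive measure $\mu$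 on $\mathcal{P}(\mathbb{N})$ has the additive property if for every increasing sequence $A_1\subseteq A_2\subseteq\cdots$ of subsets of $\mathbb{N}$ there is $B\subseteq\mathbb{N}$ with $\mu(B)=\lim_k\mu(A_k)$ and $\mu(A_k\setminus B)=0$ for all $k$.
   Formalization: In the definition of the wandering points $\mathcal{W}$, the open neighbourhood $V$ of $0\in\mathbb{R}$ is required to be bounded; with $V=\mathbb{R}$ allowed, every point of $\Omega^*$ would be wandering and the equivalence would be false. *)

theory Defs
  imports "HOL-Analysis.Analysis"
begin

(* The natural numbers are the type nat, which contains 0; nothing below depends on whether
   0 is counted, since only free ultrafilters and the sets A \<inter> {1..N} enter.
   An ultrafilter is a nat filter \<eta>; "S \<in> \<eta>" is  eventually (\<lambda>n. n \<in> S) \<eta>,  and the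
   \<eta>-limit of a sequence a is  Lim \<eta> a. *)

definition ultrafilter :: "'a filter \<Rightarrow> bool" where
  "ultrafilter F \<longleftrightarrow> F \<noteq> bot \<and>
     (\<forall>S. eventually (\<lambda>x. x \<in> S) F \<or> eventually (\<lambda>x. x \<in> - S) F)"

definition betaN :: "nat filter set" where
  "betaN = {\<eta>. ultrafilter \<eta>}"

definition betaN_top :: "nat filter topology" where
  "betaN_top = topology_generated_by (range (\<lambda>S. {\<eta> \<in> betaN. eventually (\<lambda>n. n \<in> S) \<eta>}))"

(* The remainder: n is embedded as the principal ultrafilter at n. *)
definition Nstar :: "nat filter set" where
  "Nstar = betaN - range (\<lambda>n. principal {n})"

(* The continuous extension of Suc; see tau_principal and continuous_map_tau. *)
definition tau :: "nat filter \<Rightarrow> nat filter" where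
  "tau \<eta> = filtermap Suc \<eta>"

(* Integer powers of tau on Nstar, where tau is a bijection (bij_betw_tau_Nstar). *)
definition tau_int :: "int \<Rightarrow> nat filter \<Rightarrow> nat filter" where
  "tau_int k \<eta> =
     (if 0 \<le> k then (tau ^^ nat k) \<eta> else (inv_into Nstar tau ^^ nat (- k)) \<eta>)"

definition cylinder :: "(nat filter \<times> real) set" where
  "cylinder = betaN \<times> {0..1}"

definition cylinder_top :: "(nat filter \<times> real) topology" where
  "cylinder_top = prod_topology betaN_top (top_of_set {0..1})"

definition glue :: "nat filter \<times> real \<Rightarrow> nat filter \<times> real \<Rightarrow> bool" where
  "glue p q \<longleftrightarrow> (\<exists>\<eta>. p = (\<eta>, 1) \<and> q = (tau \<eta>, 0))"

(* Since tau is injective, this is already transitive; see equiv_Omega_rel. *)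
definition Omega_rel :: "((nat filter \<times> real) \<times> (nat filter \<times> real)) set" where
  "Omega_rel = {(p, q). p \<in> cylinder \<and> q \<in> cylinder \<and> (p = q \<or> glue p q \<or> glue q p)}"

definition Omega :: "(nat filter \<times> real) set set" where
  "Omega = cylinder // Omega_rel"

(* The quotient topology; see openin_Omega_top. *)
definition Omega_top :: "(nat filter \<times> real) set topology" where
  "Omega_top = topology (\<lambda>\<U>. \<U> \<subseteq> Omega \<and> openin cylinder_top (\<Union>\<U>))"

definition Omega_star :: "(nat filter \<times> real) set set" where
  "Omega_star = {Omega_rel `` {(\<eta>, t)} | \<eta> t. \<eta> \<in> Nstar \<and> t \<in> {0..1}}"

definition Omega_star_top :: "(nat filter \<times> real) set topology" where
  "Omega_star_top = subtopology Omega_top Omega_star"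

definition flow_rep :: "real \<Rightarrow> nat filter \<times> real \<Rightarrow> nat filter \<times> real" where
  "flow_rep s = (\<lambda>(\<eta>, t). (tau_int \<lfloor>t + s\<rfloor> \<eta>, t + s - of_int \<lfloor>t + s\<rfloor>))"

(* The flow on Omega_star; it does not depend on the representative, see flow_class. *)
definition flow :: "real \<Rightarrow> (nat filter \<times> real) set \<Rightarrow> (nat filter \<times> real) set" where
  "flow s \<omega> = (\<Union>p\<in>\<omega>. Omega_rel `` {flow_rep s p})"

(* The neighbourhood V of 0 has to be taken bounded: V = UNIV would make every point wandering.
   With V bounded this is the usual notion of a wandering point of a flow, namely that
   U \<inter> flow s ` U is empty for all s with |s| large. *)
definition wandering :: "(nat filter \<times> real) set set" where
  "wandering = {\<omega> \<in> Omega_star. \<exists>U V.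
     openin Omega_star_top U \<and> \<omega> \<in> U \<and>
     open V \<and> bounded V \<and> (0::real) \<in> V \<and>
     (\<forall>s. s \<notin> V \<longrightarrow> U \<inter> flow s ` U = {})}"

(* The next two are given on representatives (\<eta>, t) with t in [0, 1]; they agree on equivalent
   ones by pow2_ultrafilter_glue and nu_glue. The image filter along n \<mapsto> [\<theta> 2^n] contains
   exactly the sets S with {n. [\<theta> 2^n] \<in> S} in \<eta>. *)
definition pow2_ultrafilter :: "nat filter \<Rightarrow> real \<Rightarrow> nat filter" where
  "pow2_ultrafilter \<eta> t = filtermap (\<lambda>n. nat \<lfloor>2 powr t * 2 ^ n\<rfloor>) \<eta>"

definition nu :: "nat filter \<Rightarrow> real \<Rightarrow> nat set \<Rightarrow> real" where
  "nu \<eta> t A =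
     Lim \<eta> (\<lambda>n. real (card (A \<inter> {1..nat \<lfloor>2 powr t * 2 ^ n\<rfloor>})) / (2 powr t * 2 ^ n))"

definition additive_property :: "(nat set \<Rightarrow> real) \<Rightarrow> bool" where
  "additive_property \<mu> \<longleftrightarrow>
     (\<forall>A. incseq A \<longrightarrow>
        (\<exists>B. (\<lambda>k. \<mu> (A k)) \<longlonglongrightarrow> \<mu> B \<and> (\<forall>k. \<mu> (A k - B) = 0)))"


lemma topspace_betaN_top [simp]: "topspace betaN_top = betaN"
  by (auto simp: betaN_top_def intro!: exI[of _ UNIV])

lemma topspace_cylinder_top [simp]: "topspace cylinder_top = cylinder"
  by (simp add: cylinder_top_def cylinder_def)

lemma ultrafilter_filtermap: "ultrafilter F \<Longrightarrow> ultrafilter (filtermap f F)"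
  unfolding ultrafilter_def eventually_filtermap filtermap_bot_iff
  by (auto dest!: spec[of _ "f -` _"])

lemma tau_betaN: "\<eta> \<in> betaN \<Longrightarrow> tau \<eta> \<in> betaN"
  by (simp add: betaN_def tau_def ultrafilter_filtermap)

lemma tau_inject: "tau \<eta> = tau \<eta>' \<longleftrightarrow> \<eta> = \<eta>'"
  by (simp add: tau_def filtermap_eq_strong)

lemma tau_principal: "tau (principal {n}) = principal {Suc n}"
  by (simp add: tau_def)

lemma continuous_map_tau: "continuous_map betaN_top betaN_top tau"
proof -
  have "openin betaN_top (tau -` {\<eta> \<in> betaN. eventually (\<lambda>n. n \<in> S) \<eta>} \<inter> betaN)" for S
  proof -
    have "tau -` {\<eta> \<in> betaN. eventually (\<lambda>n. n \<in> S) \<eta>} \<inter> betaN =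
          {\<eta> \<in> betaN. eventually (\<lambda>n. n \<in> Suc -` S) \<eta>}"
      using tau_betaN by (auto simp: tau_def eventually_filtermap)
    then show ?thesis
      unfolding betaN_top_def by (simp only:) (rule topology_generated_by_Basis, rule rangeI)
  qed
  moreover have "tau ` betaN \<subseteq> \<Union>(range (\<lambda>S. {\<eta> \<in> betaN. eventually (\<lambda>n. n \<in> S) \<eta>}))"
    using tau_betaN by (auto intro!: exI[of _ UNIV])
  ultimately show ?thesis
    unfolding betaN_top_def
    by (subst continuous_on_generated_topo_iff)
       (auto simp: betaN_top_def[symmetric])
qed

lemma bij_betw_tau_Nstar: "bij_betw tau Nstar Nstar"
proof -
  have "tau \<eta> \<in> Nstar" if "\<eta> \<in> Nstar" for \<eta>
  proof -
    have u: "ultrafilter \<eta>" and np: "\<And>n. \<eta> \<noteq> principal {n}"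
      using that by (auto simp: Nstar_def betaN_def)
    have "tau \<eta> \<noteq> principal {n}" for n
    proof (cases n)
      case 0
      have "\<not> eventually (\<lambda>x. x \<in> {0}) (tau \<eta>)"
        using u by (simp add: tau_def eventually_filtermap ultrafilter_def)
      then show ?thesis
        using 0 by (auto simp: eventually_principal)
    next
      case (Suc m)
      then show ?thesis
        using np[of m] tau_principal[of m] tau_inject by metis
    qed
    then show ?thesis
      using that tau_betaN by (auto simp: Nstar_def)
  qed
  moreover have "\<eta> \<in> tau ` Nstar" if "\<eta> \<in> Nstar" for \<eta>
  proof -
    have u: "ultrafilter \<eta>" and np: "\<And>n. \<eta> \<noteq> principal {n}"
      using that by (auto simp: Nstar_def betaN_def)
    have nz: "eventually (\<lambda>x. x \<noteq> 0) \<eta>"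
    proof (rule ccontr)
      assume "\<not> eventually (\<lambda>x. x \<noteq> 0) \<eta>"
      then have e0: "eventually (\<lambda>x. x \<in> {0}) \<eta>"
        using u unfolding ultrafilter_def by (metis (mono_tags, lifting) ComplD eventually_mono singletonI)
      have "\<eta> = principal {0}"
      proof (rule filter_eqI)
        fix P
        show "eventually P \<eta> \<longleftrightarrow> eventually P (principal {0})"
        proof
          assume "eventually P \<eta>"
          then have "eventually (\<lambda>x. x = 0 \<and> P x) \<eta>"
            using e0 by (simp add: eventually_conj)
          then have "\<exists>x. x = 0 \<and> P x"
            using u unfolding ultrafilter_def by (metis (mono_tags, lifting) eventually_happens)
          then show "eventually P (principal {0})"
            by (auto simp: eventually_principal)
        next
          assume "eventually P (principal {0})"
          then show "eventually P \<eta>"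
            using e0 by (auto simp: eventually_principal elim: eventually_mono)
        qed
      qed
      then show False using np by blast
    qed
    have eq: "tau (filtermap (\<lambda>n. n - 1) \<eta>) = \<eta>"
      unfolding tau_def filtermap_filtermap
      by (intro filter_eqI, unfold eventually_filtermap, rule eventually_cong[OF nz]) auto
    have "filtermap (\<lambda>n. n - 1) \<eta> \<noteq> principal {n}" for n
    proof
      assume "filtermap (\<lambda>n. n - 1) \<eta> = principal {n}"
      then have "\<eta> = principal {Suc n}"
        using eq tau_principal[of n] by simp
      then show False using np by blast
    qed
    then have "filtermap (\<lambda>n. n - 1) \<eta> \<in> Nstar"
      using u ultrafilter_filtermap unfolding Nstar_def betaN_def by blast
    then show ?thesis using eq by (rule rev_image_eqI[OF _ sym])
  qed
  ultimately show ?thesis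
    by (auto simp: bij_betw_def inj_on_def tau_inject)
qed

lemma equiv_Omega_rel: "equiv cylinder Omega_rel"
  by (rule equivI) (auto simp: refl_on_def sym_def trans_def Omega_rel_def glue_def tau_inject)

lemma istopology_Omega: "istopology (\<lambda>\<U>. \<U> \<subseteq> Omega \<and> openin cylinder_top (\<Union>\<U>))"
proof -
  have "\<Union>(\<U> \<inter> \<V>) = \<Union>\<U> \<inter> \<Union>\<V>" if "\<U> \<subseteq> Omega" "\<V> \<subseteq> Omega" for \<U> \<V>
    using that quotient_disj[OF equiv_Omega_rel] unfolding Omega_def by blast
  moreover have "openin cylinder_top (\<Union>(\<Union>\<K>))"
    if "\<And>\<U>. \<U> \<in> \<K> \<Longrightarrow> openin cylinder_top (\<Union>\<U>)" for \<K>
  proof -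
    have "\<Union>(\<Union>\<K>) = \<Union>(Union ` \<K>)" by auto
    also have "openin cylinder_top \<dots>" using that by (intro openin_Union) auto
    finally show ?thesis .
  qed
  ultimately show ?thesis
    unfolding istopology_def by (simp add: openin_Int Sup_le_iff le_infI1)
qed

lemma openin_Omega_top:
  "openin Omega_top \<U> \<longleftrightarrow> \<U> \<subseteq> Omega \<and> openin cylinder_top (\<Union>\<U>)"
  unfolding Omega_top_def using istopology_Omega by (simp add: topology_inverse')

lemma topspace_Omega_top: "topspace Omega_top = Omega"
proof -
  have "\<Union>Omega = topspace cylinder_top"
    by (simp add: Omega_def Union_quotient[OF equiv_Omega_rel])
  then have "openin Omega_top Omega"
    by (simp add: openin_Omega_top del: topspace_cylinder_top)
  then show ?thesis
    by (metis openin_Omega_top openin_subset openin_topspace subset_antisym)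
qed

lemma quotient_map_Omega: "quotient_map cylinder_top Omega_top (\<lambda>p. Omega_rel `` {p})"
proof -
  have "{p \<in> cylinder. Omega_rel `` {p} \<in> \<U>} = \<Union>\<U>" if "\<U> \<subseteq> Omega" for \<U>
  proof
    show "{p \<in> cylinder. Omega_rel `` {p} \<in> \<U>} \<subseteq> \<Union>\<U>"
      using equiv_class_self[OF equiv_Omega_rel] by blast
    show "\<Union>\<U> \<subseteq> {p \<in> cylinder. Omega_rel `` {p} \<in> \<U>}"
    proof
      fix p assume "p \<in> \<Union>\<U>"
      then obtain C where C: "C \<in> \<U>" "p \<in> C" by blast
      with that obtain x where x: "C = Omega_rel `` {x}"
        unfolding Omega_def by (meson quotientE subsetD)
      with C have xp: "(x, p) \<in> Omega_rel" by simp
      then have "p \<in> cylinder" by (simp add: Omega_rel_def)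
      moreover have "Omega_rel `` {p} = C"
        using x equiv_class_eq[OF equiv_Omega_rel xp] by simp
      ultimately show "p \<in> {p \<in> cylinder. Omega_rel `` {p} \<in> \<U>}" using C by simp
    qed
  qed
  then show ?thesis
    unfolding quotient_map_def
    by (auto simp: topspace_Omega_top openin_Omega_top Omega_def quotient_def)
qed

lemma tau_int_tau:
  assumes "\<eta> \<in> Nstar"
  shows "tau_int k (tau \<eta>) = tau_int (k + 1) \<eta>"
proof (cases "0 \<le> k")
  case True
  then have "nat (k + 1) = Suc (nat k)" by simp
  then show ?thesis
    using True by (simp add: tau_int_def funpow_swap1)
next
  case False
  have inv: "inv_into Nstar tau (tau \<eta>) = \<eta>"
    using assms bij_betw_tau_Nstar by (simp add: bij_betw_def)
  from False have "nat (- k) = Suc (nat (- (k + 1)))" by simp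
  then show ?thesis
    using False inv by (auto simp: tau_int_def funpow_swap1)
qed

lemma flow_class:
  assumes "\<eta> \<in> Nstar" "t \<in> {0..1}"
  shows "flow s (Omega_rel `` {(\<eta>, t)}) = Omega_rel `` {flow_rep s (\<eta>, t)}"
proof -
  have "flow_rep s q = flow_rep s (\<eta>, t)" if "q \<in> Omega_rel `` {(\<eta>, t)}" for q
  proof -
    have glued: "flow_rep s (\<zeta>, 1) = flow_rep s (tau \<zeta>, 0)" if "\<zeta> \<in> Nstar" for \<zeta>
      using tau_int_tau[OF that, of "\<lfloor>s\<rfloor>"] by (simp add: flow_rep_def add.commute)
    have "\<zeta> \<in> Nstar" if "tau \<zeta> \<in> Nstar" for \<zeta>
      using that bij_betw_tau_Nstar tau_inject unfolding bij_betw_def by (metis imageE)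
    then show ?thesis
      using that assms glued by (auto simp: Omega_rel_def glue_def)
  qed
  moreover have "(\<eta>, t) \<in> Omega_rel `` {(\<eta>, t)}"
    using assms by (auto simp: Omega_rel_def cylinder_def Nstar_def)
  ultimately have "flow_rep s ` (Omega_rel `` {(\<eta>, t)}) = {flow_rep s (\<eta>, t)}"
    by (blast intro: image_eqI)
  then have "(\<Union>r \<in> flow_rep s ` (Omega_rel `` {(\<eta>, t)}). Omega_rel `` {r}) =
      Omega_rel `` {flow_rep s (\<eta>, t)}" by simp
  then show ?thesis
    by (simp add: flow_def image_image)
qed

lemma floor_double_power: "\<lfloor>2 * 2 ^ n :: real\<rfloor> = 2 * 2 ^ n"
  using floor_of_int[of "2 * 2 ^ n", where 'a = real] by simp

lemma pow2_ultrafilter_glue: "pow2_ultrafilter (tau \<eta>) 0 = pow2_ultrafilter \<eta> 1"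
  by (simp add: pow2_ultrafilter_def tau_def filtermap_filtermap floor_double_power)

lemma nu_glue: "nu (tau \<eta>) 0 A = nu \<eta> 1 A"
  unfolding nu_def tau_def t2_space_class.Lim_def filterlim_filtermap
  by (simp add: floor_double_power)

lemma ultrafilter_compact_limit:
  fixes f :: "'a \<Rightarrow> 'b::topological_space"
  assumes "ultrafilter F" "compact K" "\<And>x. f x \<in> K"
  shows "\<exists>l\<in>K. (f \<longlongrightarrow> l) F"
proof -
  have u: "ultrafilter (filtermap f F)"
    using assms(1) by (rule ultrafilter_filtermap)
  have "eventually (\<lambda>y. y \<in> K) (filtermap f F)"
    using assms(3) by (simp add: eventually_filtermap)
  then obtain l where l: "l \<in> K" "inf (nhds l) (filtermap f F) \<noteq> bot"
    using assms(2) u unfolding compact_filter ultrafilter_def le_principal by blast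
  have "eventually (\<lambda>y. y \<in> S) (filtermap f F)" if "open S" "l \<in> S" for S
  proof (rule ccontr)
    assume "\<not> eventually (\<lambda>y. y \<in> S) (filtermap f F)"
    then have "eventually (\<lambda>y. y \<in> - S) (filtermap f F)"
      using u by (auto simp: ultrafilter_def)
    moreover have "eventually (\<lambda>y. y \<in> S) (nhds l)"
      using that by (rule eventually_nhds_in_open)
    ultimately have "eventually (\<lambda>_. False) (inf (nhds l) (filtermap f F))"
      unfolding eventually_inf by fastforce
    then show False using l(2) by (simp add: eventually_False)
  qed
  then have "(f \<longlongrightarrow> l) F"
    by (simp add: tendsto_def eventually_filtermap)
  then show ?thesis using l(1) by blast
qed

lemma nu_tendsto:
  assumes "\<eta> \<in> Nstar"
  shows "((\<lambda>n. real (card (A \<inter> {1..nat \<lfloor>2 powr t * 2 ^ n\<rfloor>})) / (2 powr t * 2 ^ n))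
           \<longlongrightarrow> nu \<eta> t A) \<eta>"
proof -
  let ?f = "\<lambda>n. real (card (A \<inter> {1..nat \<lfloor>2 powr t * 2 ^ n\<rfloor>})) / (2 powr t * 2 ^ n)"
  have "?f n \<in> {0..1}" for n
  proof -
    have pos: "0 < 2 powr t * 2 ^ n" by simp
    have "card (A \<inter> {1..nat \<lfloor>2 powr t * 2 ^ n\<rfloor>}) \<le> card {1..nat \<lfloor>2 powr t * 2 ^ n\<rfloor>}"
      by (rule card_mono) auto
    then have "real (card (A \<inter> {1..nat \<lfloor>2 powr t * 2 ^ n\<rfloor>})) \<le> real (nat \<lfloor>2 powr t * 2 ^ n\<rfloor>)"
      unfolding card_atLeastAtMost of_nat_le_iff by linarith
    also have "\<dots> \<le> 2 powr t * 2 ^ n"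
      using pos by (intro of_nat_floor) simp
    finally show ?thesis
      using pos by (simp add: divide_le_eq)
  qed
  moreover have u: "ultrafilter \<eta>"
    using assms by (simp add: Nstar_def betaN_def)
  ultimately obtain l where "(?f \<longlongrightarrow> l) \<eta>"
    using ultrafilter_compact_limit[of \<eta> "{0..1}" ?f] compact_Icc by blast
  then show ?thesis
    using u tendsto_Lim[of \<eta> ?f l] by (simp add: nu_def ultrafilter_def)
qed

end

theory Submission
  imports Defs
begin

text \<open>
  Both sides say that \<open>\<eta>\<close> contains a set \<open>S\<close> whose consecutive gaps tend to infinity
  (\<open>spread\<close> below). On the left, the lacunary set \<open>m\<close> is the image of such an \<open>S\<close> under
  \<open>n \<mapsto> [\<theta> 2 ^ n]\<close>. On the right, a basic neighbourhood of \<open>\<omega>\<close> disjoint from its translates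
  for large times yields \<open>S\<close> such that \<open>S \<inter> (S - k)\<close> is finite for all \<open>k \<ge> M\<close>; intersecting
  \<open>S\<close> with the residue class modulo \<open>M\<close> that belongs to \<open>\<eta>\<close> removes the small gaps.

  The additive property is then automatic. Put \<open>N n = [\<theta> 2 ^ n]\<close>. For \<open>n \<in> S\<close> the
  predecessor \<open>n'\<close> of \<open>n\<close> in \<open>S\<close> satisfies \<open>N n' / N n \<rightarrow> 0\<close>, so the density of a set at \<open>N n\<close>
  is decided on the block \<open>(N n', N n]\<close>. Let \<open>B\<close> agree there with \<open>A (J n)\<close>, where
  \<open>J n \<le> n\<close> is the largest index \<open>j\<close> for which the density of \<open>A j\<close> at \<open>N n\<close> exceeds
  \<open>lim \<nu> (A j)\<close> by at most \<open>1 / (j + 1)\<close>. Then \<open>J\<close> tends to infinity along \<open>\<eta>\<close>.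
\<close>

text \<open>Phrasing the growth of gaps through each fixed difference, without an enumeration,
  matches the sets of return times produced by the flow.\<close>

definition spread :: "nat set \<Rightarrow> bool" where
  "spread S \<longleftrightarrow> (\<forall>d>0. finite {n \<in> S. n + d \<in> S})"

section \<open>Free ultrafilters on the naturals\<close>

lemma ultrafilter_not_eventually:
  assumes "ultrafilter F" "\<not> eventually P F"
  shows "eventually (\<lambda>x. \<not> P x) F"
  using assms unfolding ultrafilter_def by (auto dest!: spec[of _ "Collect P"])

lemma ultrafilter_singleton:
  assumes "ultrafilter F" "eventually (\<lambda>x. x = a) F"
  shows "F = principal {a}"
proof (rule antisym)
  show "F \<le> principal {a}"
    using assms(2) by (simp add: le_principal)
  show "principal {a} \<le> F"
  proof (rule filter_leI)
    fix P assume "eventually P F"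
    then have "eventually (\<lambda>x. x = a \<and> P x) F"
      using assms(2) by eventually_elim simp
    moreover have "F \<noteq> bot"
      using assms(1) by (simp add: ultrafilter_def)
    ultimately have "\<exists>x. x = a \<and> P x"
      by (rule eventually_happens'[rotated])
    then show "eventually P (principal {a})"
      by (simp add: eventually_principal)
  qed
qed

text \<open>An ultrafilter that is not principal contains the complement of every singleton, hence
  of every initial segment; this is what refining \<open>sequentially\<close> means.\<close>

lemma Nstar_iff: "\<eta> \<in> Nstar \<longleftrightarrow> ultrafilter \<eta> \<and> \<eta> \<le> sequentially"
proof
  assume \<eta>: "\<eta> \<in> Nstar"
  then have u: "ultrafilter \<eta>" and np: "\<And>n. \<eta> \<noteq> principal {n}"
    by (auto simp: Nstar_def betaN_def)
  have ne: "eventually (\<lambda>n. n \<noteq> k) \<eta>" for k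
    using ultrafilter_not_eventually[OF u, of "\<lambda>n. n = k"] ultrafilter_singleton[OF u] np by blast
  have "eventually P \<eta>" if "eventually P sequentially" for P
  proof -
    obtain N where N: "\<And>n. N \<le> n \<Longrightarrow> P n"
      using \<open>eventually P sequentially\<close> by (auto simp: eventually_sequentially)
    have "eventually (\<lambda>n. \<forall>k\<in>{..<N}. n \<noteq> k) \<eta>"
      by (intro eventually_ball_finite) (auto intro: ne)
    then show ?thesis
      proof eventually_elim
      case (elim n)
      then show ?case
        using N[of n] by (cases "n < N") auto
    qed
  qed
  then show "ultrafilter \<eta> \<and> \<eta> \<le> sequentially"
    using u by (auto intro: filter_leI)
next
  assume \<eta>: "ultrafilter \<eta> \<and> \<eta> \<le> sequentially"
  have "\<eta> \<noteq> principal {n}" for n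
  proof
    assume eq: "\<eta> = principal {n}"
    have "eventually (\<lambda>k. n < k) \<eta>"
      using \<eta> eventually_gt_at_top filter_leD by blast
    then show False
      by (simp add: eq eventually_principal)
  qed
  then show "\<eta> \<in> Nstar"
    using \<eta> by (auto simp: Nstar_def betaN_def)
qed

lemma Nstar_finite:
  assumes "\<eta> \<in> Nstar" "finite A"
  shows "eventually (\<lambda>n. n \<notin> A) \<eta>"
proof -
  have "eventually (\<lambda>n. n \<notin> A) sequentially"
    using assms(2) by (simp add: cofinite_eq_sequentially[symmetric] eventually_cofinite)
  then show ?thesis
    using assms(1) filter_leD by (auto simp: Nstar_iff)
qed

lemma Nstar_eventually_infinite:
  assumes "\<eta> \<in> Nstar" "eventually (\<lambda>n. n \<in> A) \<eta>"
  shows "infinite A"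
proof
  assume "finite A"
  then have "eventually (\<lambda>n. n \<notin> A) \<eta>"
    by (rule Nstar_finite[OF assms(1)])
  with assms(2) have "eventually (\<lambda>n. False) \<eta>"
    by eventually_elim simp
  then show False
    using assms(1) by (simp add: Nstar_iff ultrafilter_def eventually_False)
qed

lemma Nstar_filtermap:
  assumes "\<eta> \<in> Nstar" "strict_mono f"
  shows "filtermap f \<eta> \<in> Nstar"
proof -
  have "filterlim f sequentially \<eta>"
    using filterlim_mono[OF filterlim_subseq[OF assms(2)] order_refl] assms(1)
    by (simp add: Nstar_iff)
  then show ?thesis
    using assms(1) by (simp add: Nstar_iff filterlim_def ultrafilter_filtermap)
qed

text \<open>Pushing the given free ultrafilter forward along the enumeration of \<open>A\<close>
  gives one that contains \<open>A\<close>, without a new appeal to Zorn's lemma.\<close>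

lemma exists_Nstar_containing:
  assumes "\<eta> \<in> Nstar" "infinite A"
  shows "\<exists>\<zeta>\<in>Nstar. eventually (\<lambda>n. n \<in> A) \<zeta>"
  using Nstar_filtermap[OF assms(1) strict_mono_enumerate[OF assms(2)]]
  by (rule bexI[rotated]) (simp add: eventually_filtermap enumerate_in_set assms(2))

section \<open>Powers of \<open>tau\<close> and return times\<close>

lemma eventually_tau: "eventually P (tau \<eta>) \<longleftrightarrow> eventually (\<lambda>n. P (Suc n)) \<eta>"
  by (simp add: tau_def eventually_filtermap)

lemma eventually_funpow_tau: "eventually P ((tau ^^ k) \<eta>) \<longleftrightarrow> eventually (\<lambda>n. P (n + k)) \<eta>"
  by (induction k arbitrary: P) (simp_all add: eventually_tau)

lemma inv_tau:
  assumes "\<eta> \<in> Nstar"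
  shows "inv_into Nstar tau \<eta> \<in> Nstar" "tau (inv_into Nstar tau \<eta>) = \<eta>"
  using assms bij_betw_tau_Nstar by (simp_all add: bij_betw_def inv_into_into f_inv_into_f)

lemma funpow_inv_tau:
  assumes "\<eta> \<in> Nstar"
  shows "(inv_into Nstar tau ^^ k) \<eta> \<in> Nstar \<and> (tau ^^ k) ((inv_into Nstar tau ^^ k) \<eta>) = \<eta>"
proof (induction k)
  case (Suc k)
  then show ?case
    using inv_tau[of "(inv_into Nstar tau ^^ k) \<eta>"] by (simp add: funpow_swap1)
qed (simp add: assms)

lemma tau_Nstar: "tau \<eta> \<in> Nstar \<longleftrightarrow> \<eta> \<in> Nstar"
  using bij_betw_tau_Nstar tau_inject unfolding bij_betw_def by (metis imageE imageI)

lemma funpow_tau_Nstar: "\<eta> \<in> Nstar \<Longrightarrow> (tau ^^ k) \<eta> \<in> Nstar"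
  by (induction k) (simp_all add: tau_Nstar)

lemma tau_int_Nstar: "\<eta> \<in> Nstar \<Longrightarrow> tau_int k \<eta> \<in> Nstar"
  by (simp add: tau_int_def funpow_tau_Nstar funpow_inv_tau)

text \<open>The return set belongs to a free ultrafilter: to \<open>\<eta>\<close> itself if
  \<open>k\<close> is nonnegative, otherwise to \<open>tau_int k \<eta>\<close>, from which a
  forward power of \<open>tau\<close> leads back to \<open>\<eta>\<close>.\<close>

lemma infinite_tau_int_return:
  assumes "\<eta> \<in> Nstar" "eventually (\<lambda>n. n \<in> T) \<eta>" "eventually (\<lambda>n. n \<in> T) (tau_int k \<eta>)"
  shows "infinite {n \<in> T. n + nat \<bar>k\<bar> \<in> T}"
proof (cases "0 \<le> k")
  case True
  then have "eventually (\<lambda>n. n + nat k \<in> T) \<eta>"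
    using assms(3) by (simp add: tau_int_def eventually_funpow_tau)
  with assms(2) have "eventually (\<lambda>n. n \<in> {n \<in> T. n + nat \<bar>k\<bar> \<in> T}) \<eta>"
    by eventually_elim (simp add: True)
  then show ?thesis
    by (rule Nstar_eventually_infinite[OF assms(1)])
next
  case False
  define \<zeta> where "\<zeta> = tau_int k \<eta>"
  have \<zeta>: "\<zeta> \<in> Nstar" "(tau ^^ nat \<bar>k\<bar>) \<zeta> = \<eta>"
    using False funpow_inv_tau[OF assms(1)] by (simp_all add: \<zeta>_def tau_int_def)
  have "eventually (\<lambda>n. n + nat \<bar>k\<bar> \<in> T) \<zeta>"
    using assms(2) unfolding \<zeta>(2)[symmetric] eventually_funpow_tau .
  moreover have "eventually (\<lambda>n. n \<in> T) \<zeta>"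
    using assms(3) by (simp add: \<zeta>_def)
  ultimately have "eventually (\<lambda>n. n \<in> {n \<in> T. n + nat \<bar>k\<bar> \<in> T}) \<zeta>"
    by eventually_elim simp
  then show ?thesis
    by (rule Nstar_eventually_infinite[OF \<zeta>(1)])
qed

section \<open>Neighbourhoods in \<open>betaN\<close> and in the quotient\<close>

lemma openin_betaN_basic: "openin betaN_top {\<eta> \<in> betaN. eventually (\<lambda>n. n \<in> S) \<eta>}"
  unfolding betaN_top_def by (rule topology_generated_by_Basis) (rule rangeI)

text \<open>The generating sets form a base and not only a subbase, because the ones for
  \<open>S\<close> and \<open>T\<close> intersect in the one for
  \<open>S \<inter> T\<close>.\<close>

lemma openin_betaN_nbhd:
  assumes "openin betaN_top A" "\<eta> \<in> A"
  shows "\<exists>S. eventually (\<lambda>n. n \<in> S) \<eta> \<and> {\<zeta> \<in> betaN. eventually (\<lambda>n. n \<in> S) \<zeta>} \<subseteq> A"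
proof -
  have "generate_topology_on (range (\<lambda>S. {\<eta> \<in> betaN. eventually (\<lambda>n. n \<in> S) \<eta>})) A"
    using assms(1) by (simp add: betaN_top_def openin_topology_generated_by_iff)
  then show ?thesis
    using assms(2)
  proof (induction arbitrary: \<eta>)
    case Empty
    then show ?case by simp
  next
    case (Int a b)
    from Int.prems Int.IH obtain S T where
      S: "eventually (\<lambda>n. n \<in> S) \<eta>" "{\<zeta> \<in> betaN. eventually (\<lambda>n. n \<in> S) \<zeta>} \<subseteq> a" and
      T: "eventually (\<lambda>n. n \<in> T) \<eta>" "{\<zeta> \<in> betaN. eventually (\<lambda>n. n \<in> T) \<zeta>} \<subseteq> b"
      by blast
    then show ?case
      by (intro exI[of _ "S \<inter> T"]) (auto simp: eventually_conj_iff)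
  next
    case (UN K)
    then obtain k where k: "k \<in> K" "\<eta> \<in> k" by blast
    show ?case
      using UN.IH[OF k] k(1) by (meson Union_upper subset_trans)
  next
    case (Basis s)
    then show ?case by auto
  qed
qed

lemma Omega_star_rep:
  assumes "\<omega> \<in> Omega_star" "(\<eta>, t) \<in> \<omega>"
  shows "\<eta> \<in> Nstar" "t \<in> {0..1}" "\<omega> = Omega_rel `` {(\<eta>, t)}"
proof -
  obtain \<zeta> s where \<zeta>: "\<omega> = Omega_rel `` {(\<zeta>, s)}" "\<zeta> \<in> Nstar" "s \<in> {0..1}"
    using assms(1) by (auto simp: Omega_star_def)
  then have rel: "((\<zeta>, s), (\<eta>, t)) \<in> Omega_rel"
    using assms(2) by simp
  then show "\<omega> = Omega_rel `` {(\<eta>, t)}"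
    using \<zeta>(1) equiv_class_eq[OF equiv_Omega_rel] by blast
  show "\<eta> \<in> Nstar" "t \<in> {0..1}"
    using rel \<zeta>(2,3) by (auto simp: Omega_rel_def glue_def cylinder_def tau_Nstar)
qed

lemma openin_Omega_star_top:
  "openin Omega_star_top U \<longleftrightarrow> (\<exists>U'. U' \<subseteq> Omega \<and> openin cylinder_top (\<Union>U') \<and> U = U' \<inter> Omega_star)"
  by (auto simp: Omega_star_top_def openin_subtopology openin_Omega_top)

text \<open>The union of a set of classes is saturated, so membership of a class can be tested on
  any representative.\<close>

lemma Omega_class_iff:
  assumes "U \<subseteq> Omega" "p \<in> cylinder"
  shows "Omega_rel `` {p} \<in> U \<longleftrightarrow> p \<in> \<Union>U"
proof
  assume "Omega_rel `` {p} \<in> U"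
  then show "p \<in> \<Union>U"
    using equiv_class_self[OF equiv_Omega_rel assms(2)] by blast
next
  assume "p \<in> \<Union>U"
  then obtain C where C: "C \<in> U" "p \<in> C" by blast
  then obtain q where "C = Omega_rel `` {q}"
    using assms(1) unfolding Omega_def by (meson quotientE subsetD)
  then show "Omega_rel `` {p} \<in> U"
    using C equiv_class_eq[OF equiv_Omega_rel, of q p] by auto
qed

section \<open>Wandering points and spread sets\<close>

lemma wandering_imp_spread:
  assumes \<omega>: "\<omega> \<in> wandering" and \<eta>t: "(\<eta>, t) \<in> \<omega>"
  shows "\<exists>S. spread S \<and> eventually (\<lambda>n. n \<in> S) \<eta>"
proof -
  obtain U V where UV: "openin Omega_star_top U" "\<omega> \<in> U" "bounded V"
      "\<And>s. s \<notin> V \<Longrightarrow> U \<inter> flow s ` U = {}" and star: "\<omega> \<in> Omega_star"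
    using \<omega> by (auto simp: wandering_def)
  note rep = Omega_star_rep[OF star \<eta>t]
  obtain U' where U': "U' \<subseteq> Omega" "openin cylinder_top (\<Union>U')" "U = U' \<inter> Omega_star"
    using UV(1) by (auto simp: openin_Omega_star_top)
  have "(\<eta>, t) \<in> \<Union>U'"
    using UV(2) U'(3) \<eta>t by blast
  then obtain A B where AB: "openin betaN_top A" "\<eta> \<in> A" "t \<in> B" "A \<times> B \<subseteq> \<Union>U'"
    using U'(2) unfolding cylinder_top_def openin_prod_topology_alt by meson
  obtain S where S: "eventually (\<lambda>n. n \<in> S) \<eta>" "{\<zeta> \<in> betaN. eventually (\<lambda>n. n \<in> S) \<zeta>} \<subseteq> A"
    using openin_betaN_nbhd[OF AB(1,2)] by blast
  have inU: "Omega_rel `` {(\<zeta>, t)} \<in> U" if "\<zeta> \<in> Nstar" "eventually (\<lambda>n. n \<in> S) \<zeta>" for \<zeta>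
  proof -
    have \<zeta>: "\<zeta> \<in> betaN"
      using that(1) by (simp add: Nstar_def)
    then have "(\<zeta>, t) \<in> \<Union>U'"
      using S(2) AB(3,4) that(2) by blast
    then have "Omega_rel `` {(\<zeta>, t)} \<in> U'"
      using Omega_class_iff[OF U'(1), of "(\<zeta>, t)"] \<zeta> rep(2) by (simp add: cylinder_def)
    then show ?thesis
      using that(1) rep(2) by (auto simp: U'(3) Omega_star_def)
  qed
  \<comment> \<open>Integer times move only the ultrafilter coordinate. At \<open>t = 1\<close> the
    floor is \<open>k + 1\<close>, so \<open>flow_rep\<close> lands at height 0 over one further
    power of \<open>tau\<close>; the gluing takes this back to height 1.\<close>
  have flow_nat: "flow (real k) (Omega_rel `` {(\<zeta>, t)}) = Omega_rel `` {((tau ^^ k) \<zeta>, t)}"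
    if \<zeta>: "\<zeta> \<in> Nstar" for \<zeta> k
  proof (cases "t = 1")
    case True
    have "nat (1 + int k) = Suc k" by simp
    then have "flow_rep (real k) (\<zeta>, t) = (tau ((tau ^^ k) \<zeta>), 0)"
      by (simp add: True flow_rep_def tau_int_def)
    moreover have "(((tau ^^ k) \<zeta>, 1), (tau ((tau ^^ k) \<zeta>), 0)) \<in> Omega_rel"
      using funpow_tau_Nstar[OF \<zeta>, of k] tau_betaN
      by (auto simp: Omega_rel_def glue_def cylinder_def Nstar_def)
    ultimately show ?thesis
      using flow_class[OF \<zeta> rep(2)] equiv_class_eq[OF equiv_Omega_rel] True by simp
  next
    case False
    then have "\<lfloor>t\<rfloor> = 0"
      using rep(2) by (auto simp: floor_eq_iff)
    moreover have "0 \<le> t + real k"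
      using rep(2) by simp
    ultimately show ?thesis
      using flow_class[OF \<zeta> rep(2)] by (simp add: flow_rep_def tau_int_def)
  qed
  obtain M where M: "M > 0" "\<And>k. k \<ge> M \<Longrightarrow> real k \<notin> V"
  proof -
    obtain b where b: "\<And>x. x \<in> V \<Longrightarrow> norm x \<le> b"
      using UV(3) by (auto simp: bounded_iff)
    obtain M where "b < real M"
      using reals_Archimedean2 by blast
    then have "real k \<notin> V" if "k \<ge> Suc M" for k
      using b[of "real k"] that by auto
    then show ?thesis
      by (intro that[of "Suc M"]) auto
  qed
  \<comment> \<open>An infinite return set would lie in some free \<open>\<zeta>\<close>. Then the
    classes of \<open>\<zeta>\<close> and of its \<open>k\<close>-th translate, both at height
    \<open>t\<close>, are in \<open>U\<close>, although the time \<open>k\<close> is outside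
    \<open>V\<close>.\<close>
  have fin: "finite {n \<in> S. n + k \<in> S}" if "k \<ge> M" for k
  proof (rule ccontr)
    assume "infinite {n \<in> S. n + k \<in> S}"
    then obtain \<zeta> where \<zeta>: "\<zeta> \<in> Nstar" "eventually (\<lambda>n. n \<in> {n \<in> S. n + k \<in> S}) \<zeta>"
      using exists_Nstar_containing[OF rep(1)] by blast
    have "eventually (\<lambda>n. n \<in> S) \<zeta>" "eventually (\<lambda>n. n \<in> S) ((tau ^^ k) \<zeta>)"
      using \<zeta>(2) unfolding eventually_funpow_tau by (auto elim: eventually_mono)
    then have "Omega_rel `` {(\<zeta>, t)} \<in> U" "flow (real k) (Omega_rel `` {(\<zeta>, t)}) \<in> U"
      unfolding flow_nat[OF \<zeta>(1)] using inU \<zeta>(1) funpow_tau_Nstar by blast+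
    then show False
      using UV(4)[OF M(2)[OF that]] by blast
  qed
  \<comment> \<open>The residue classes modulo \<open>M\<close> are a finite partition, so an
    ultrafilter contains one of them.\<close>
  have "\<exists>r<M. eventually (\<lambda>n. n mod M = r) \<eta>"
  proof (rule ccontr)
    assume "\<not> (\<exists>r<M. eventually (\<lambda>n. n mod M = r) \<eta>)"
    then have "eventually (\<lambda>n. \<forall>r\<in>{..<M}. n mod M \<noteq> r) \<eta>"
      using rep(1) ultrafilter_not_eventually
      by (intro eventually_ball_finite) (auto simp: Nstar_iff)
    then have "eventually (\<lambda>n. False) \<eta>"
      by eventually_elim (use M(1) in auto)
    then show False
      using rep(1) by (simp add: Nstar_iff ultrafilter_def eventually_False)
  qed
  then obtain r where r: "eventually (\<lambda>n. n mod M = r) \<eta>" by blast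
  define S' where "S' = {n \<in> S. n mod M = r}"
  \<comment> \<open>Differences of elements of a residue class modulo \<open>M\<close> are zero or at least \<open>M\<close>.\<close>
  have "spread S'"
    unfolding spread_def
  proof (intro allI impI)
    fix d :: nat assume "d > 0"
    show "finite {n \<in> S'. n + d \<in> S'}"
    proof (cases "d \<ge> M")
      case True
      then show ?thesis
        by (rule finite_subset[rotated, OF fin]) (auto simp: S'_def)
    next
      case False
      have "{n \<in> S'. n + d \<in> S'} = {}"
      proof -
        have "(n + d) mod M \<noteq> n mod M" for n
        proof
          assume "(n + d) mod M = n mod M"
          then have "M dvd d"
            using mod_eq_dvd_iff_nat[of n "n + d" M] by simp
          then show False
            using False \<open>d > 0\<close> by (auto dest: dvd_imp_le)
        qed
        then show ?thesis by (auto simp: S'_def)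
      qed
      then show ?thesis by (simp only: finite.emptyI)
    qed
  qed
  moreover have "eventually (\<lambda>n. n \<in> S') \<eta>"
    using S(1) r by eventually_elim (simp add: S'_def)
  ultimately show ?thesis by blast
qed

text \<open>A difference \<open>k\<close> in the enlarged set comes from a difference
  \<open>k - 1\<close>, \<open>k\<close> or \<open>k + 1\<close> in \<open>S\<close>, and all three
  are positive once \<open>k \<ge> 2\<close>. For \<open>k = 1\<close> the claim fails for infinite
  \<open>S\<close>, since every pair \<open>n\<close>, \<open>n + 1\<close> with \<open>n\<close> in
  \<open>S\<close> counts.\<close>

lemma spread_Un_Suc:
  assumes "spread S" "k \<ge> 2"
  shows "finite {n \<in> S \<union> Suc ` S. n + k \<in> S \<union> Suc ` S}"
proof -
  let ?R = "\<lambda>d. {n \<in> S. n + d \<in> S}"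
  have R: "finite (?R d)" if "d > 0" for d
    using assms(1) that by (simp add: spread_def)
  have fin: "finite (?R k \<union> Suc ` ?R k \<union> ?R (k - 1) \<union> Suc ` ?R (Suc k))"
    by (intro finite_UnI finite_imageI R) (use assms(2) in auto)
  have "{n \<in> S \<union> Suc ` S. n + k \<in> S \<union> Suc ` S} \<subseteq>
      ?R k \<union> Suc ` ?R k \<union> ?R (k - 1) \<union> Suc ` ?R (Suc k)"
  proof
    fix n assume "n \<in> {n \<in> S \<union> Suc ` S. n + k \<in> S \<union> Suc ` S}"
    then consider "n \<in> S" "n + k \<in> S" | m where "n = Suc m" "m \<in> S" "n + k \<in> S"
      | m where "n \<in> S" "n + k = Suc m" "m \<in> S"
      | m m' where "n = Suc m" "m \<in> S" "n + k = Suc m'" "m' \<in> S"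
      by blast
    then show "n \<in> ?R k \<union> Suc ` ?R k \<union> ?R (k - 1) \<union> Suc ` ?R (Suc k)"
    proof cases
      case 3
      then have "n + (k - 1) = m" using assms(2) by simp
      then show ?thesis using 3 by simp
    qed auto
  qed
  then show ?thesis
    by (rule finite_subset) (rule fin)
qed

lemma spread_imp_wandering_aux:
  assumes \<eta>: "\<eta> \<in> Nstar" and t: "t \<in> {0<..1}"
    and S: "spread S" "eventually (\<lambda>n. n \<in> S) \<eta>"
  shows "Omega_rel `` {(\<eta>, t)} \<in> wandering"
proof -
  \<comment> \<open>The second part is forced by the gluing, which carries \<open>(\<zeta>, 1)\<close> to \<open>(tau \<zeta>, 0)\<close>.\<close>
  define W where "W = {\<zeta> \<in> betaN. eventually (\<lambda>n. n \<in> S) \<zeta>} \<times> {0<..1::real} \<union>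
    {\<zeta> \<in> betaN. eventually (\<lambda>n. n \<in> Suc ` S) \<zeta>} \<times> {0..<1}"
  \<comment> \<open>\<open>T\<close> belongs to the ultrafilter coordinate of every point of
    \<open>W\<close>, whichever of the two boxes the point lies in.\<close>
  define T where "T = S \<union> Suc ` S"
  have Wcyl: "W \<subseteq> cylinder"
    by (auto simp: W_def cylinder_def)
  have "openin (top_of_set {0..1}) {0<..1::real}"
    by (auto simp: openin_open intro!: exI[of _ "{0<..}"])
  moreover have "openin (top_of_set {0..1}) {0..<1::real}"
    by (auto simp: openin_open intro!: exI[of _ "{..<1}"])
  ultimately have Wopen: "openin cylinder_top W"
    unfolding W_def cylinder_top_def
    by (intro openin_Un) (auto simp: openin_prod_Times_iff openin_betaN_basic)
  have glueW: "(\<zeta>, 1) \<in> W \<longleftrightarrow> (tau \<zeta>, 0) \<in> W" if "\<zeta> \<in> betaN" for \<zeta>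
    using that tau_betaN[OF that] by (simp add: W_def eventually_tau image_iff)
  \<comment> \<open>Saturation makes \<open>W\<close> the full preimage of its set of classes, which
    is therefore open in the quotient.\<close>
  have sat: "q \<in> W" if "p \<in> W" "(p, q) \<in> Omega_rel" for p q
    using that glueW by (auto simp: Omega_rel_def glue_def cylinder_def)
  define U' where "U' = (\<lambda>p. Omega_rel `` {p}) ` W"
  have U'W: "\<Union>U' = W"
    using sat equiv_class_self[OF equiv_Omega_rel] Wcyl by (fastforce simp: U'_def)
  have U'Om: "U' \<subseteq> Omega"
    using Wcyl by (auto simp: U'_def Omega_def intro: quotientI)
  define U where "U = U' \<inter> Omega_star"
  have "openin Omega_star_top U"
    unfolding openin_Omega_star_top using U'Om Wopen U'W U_def by blast
  moreover have star: "Omega_rel `` {(\<eta>, t)} \<in> Omega_star"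
    unfolding Omega_star_def using \<eta> t by (intro CollectI exI[of _ \<eta>] exI[of _ t]) auto
  moreover have "Omega_rel `` {(\<eta>, t)} \<in> U"
    using star \<eta> t S(2) by (auto simp: U_def U'_def W_def Nstar_def)
  \<comment> \<open>Since \<open>r\<close> is in \<open>[0, 1]\<close>, a time with absolute value
    at least 4 gives an integer part \<open>k\<close> of absolute value at least 3, which is enough
    for \<open>spread_Un_Suc\<close>.\<close>
  moreover have "U \<inter> flow s ` U = {}" if s: "s \<notin> {-4<..<4}" for s
  proof (rule ccontr)
    assume "U \<inter> flow s ` U \<noteq> {}"
    then obtain u where u: "u \<in> U" "flow s u \<in> U" by blast
    obtain \<zeta> r where \<zeta>: "u = Omega_rel `` {(\<zeta>, r)}" "\<zeta> \<in> Nstar" "r \<in> {0..1}"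
      using u(1) by (auto simp: U_def Omega_star_def)
    define k where "k = \<lfloor>r + s\<rfloor>"
    have rep: "flow_rep s (\<zeta>, r) = (tau_int k \<zeta>, frac (r + s))"
      by (simp add: flow_rep_def k_def frac_def)
    have T: "eventually (\<lambda>n. n \<in> T) \<xi>"
      if "\<xi> \<in> Nstar" "x \<in> {0..1}" "Omega_rel `` {(\<xi>, x)} \<in> U" for \<xi> x
    proof -
      have "(\<xi>, x) \<in> W"
        using Omega_class_iff[OF U'Om, of "(\<xi>, x)"] that
        by (simp add: U_def U'W cylinder_def Nstar_def)
      then show ?thesis
        by (auto simp: W_def T_def elim: eventually_mono)
    qed
    have "eventually (\<lambda>n. n \<in> T) \<zeta>"
      using T \<zeta> u(1) by blast
    moreover have "eventually (\<lambda>n. n \<in> T) (tau_int k \<zeta>)"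
    proof (rule T)
      show "frac (r + s) \<in> {0..1}"
        using frac_lt_1[of "r + s"] by (simp add: less_imp_le)
      show "Omega_rel `` {(tau_int k \<zeta>, frac (r + s))} \<in> U"
        using u(2) unfolding \<zeta>(1) flow_class[OF \<zeta>(2,3)] rep .
    qed (rule tau_int_Nstar[OF \<zeta>(2)])
    ultimately have "infinite {n \<in> T. n + nat \<bar>k\<bar> \<in> T}"
      by (rule infinite_tau_int_return[OF \<zeta>(2)])
    moreover have "nat \<bar>k\<bar> \<ge> 2"
    proof -
      have "\<bar>k\<bar> \<ge> 2"
        using s \<zeta>(3) unfolding k_def greaterThanLessThan_iff atLeastAtMost_iff by linarith
      then show ?thesis by simp
    qed
    ultimately show False
      using spread_Un_Suc[OF S(1)] by (simp add: T_def)
  qed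
  ultimately show ?thesis
    unfolding wandering_def
    by (intro CollectI conjI exI[of _ U] exI[of _ "{-4<..<4::real}"]) auto
qed

text \<open>Height 0 is outside the box used above; such a point is rewritten at height 1 over the
  \<open>tau\<close>-preimage of \<open>\<eta>\<close>, with \<open>S\<close> shifted down by
  one.\<close>

lemma spread_imp_wandering:
  assumes star: "\<omega> \<in> Omega_star" and \<eta>t: "(\<eta>, t) \<in> \<omega>"
    and S: "spread S" "eventually (\<lambda>n. n \<in> S) \<eta>"
  shows "\<omega> \<in> wandering"
proof -
  note rep = Omega_star_rep[OF star \<eta>t]
  show ?thesis
  proof (cases "t = 0")
    case False
    then show ?thesis
      using spread_imp_wandering_aux[OF rep(1) _ S] rep(2,3) by auto
  next
    case True
    define \<zeta> where "\<zeta> = inv_into Nstar tau \<eta>"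
    have \<zeta>: "\<zeta> \<in> Nstar" "tau \<zeta> = \<eta>"
      using inv_tau[OF rep(1)] by (simp_all add: \<zeta>_def)
    have "((\<zeta>, 1), (\<eta>, t)) \<in> Omega_rel"
      using \<zeta> rep(1) by (auto simp: Omega_rel_def glue_def cylinder_def Nstar_def True)
    then have eq: "\<omega> = Omega_rel `` {(\<zeta>, 1)}"
      using rep(3) equiv_class_eq[OF equiv_Omega_rel] by blast
    have "spread (Suc -` S)"
      unfolding spread_def
    proof (intro allI impI)
      fix d :: nat assume "d > 0"
      then have "finite (Suc -` {n \<in> S. n + d \<in> S})"
        using S(1) by (intro finite_vimageI) (auto simp: spread_def)
      then show "finite {n \<in> Suc -` S. n + d \<in> Suc -` S}"
        by (rule back_subst[of finite]) auto
    qed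
    moreover have "eventually (\<lambda>n. n \<in> Suc -` S) \<zeta>"
      using S(2) unfolding \<zeta>(2)[symmetric] eventually_tau by simp
    ultimately show ?thesis
      using spread_imp_wandering_aux[OF \<zeta>(1), of 1] by (simp add: eq)
  qed
qed

section \<open>Lacunary sets and the integers \<open>[\<theta> 2 ^ n]\<close>\<close>

definition scaled_pow2 :: "real \<Rightarrow> nat \<Rightarrow> nat" where
  "scaled_pow2 t n = nat \<lfloor>2 powr t * 2 ^ n\<rfloor>"

lemma scaled_pow2_le: "real (scaled_pow2 t n) \<le> 2 powr t * 2 ^ n"
  unfolding scaled_pow2_def by (rule of_nat_floor) simp

lemma scaled_pow2_gt: "2 powr t * 2 ^ n < real (scaled_pow2 t n) + 1"
  unfolding scaled_pow2_def by linarith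

lemma scaled_pow2_mono: "n \<le> n' \<Longrightarrow> scaled_pow2 t n \<le> scaled_pow2 t n'"
  unfolding scaled_pow2_def by (intro nat_mono floor_mono mult_left_mono power_increasing) auto

lemma scaled_pow2_ge_1:
  assumes "t \<ge> 0"
  shows "1 \<le> scaled_pow2 t n"
proof -
  have "1 * 1 \<le> 2 powr t * 2 ^ n"
    using assms by (intro mult_mono ge_one_powr_ge_zero one_le_power) auto
  then show ?thesis
    unfolding scaled_pow2_def by linarith
qed

lemma strict_mono_scaled_pow2:
  assumes "t \<ge> 0"
  shows "strict_mono (scaled_pow2 t)"
proof -
  have "scaled_pow2 t n < scaled_pow2 t (Suc n)" for n
  proof -
    have "2 * real (scaled_pow2 t n) \<le> 2 powr t * 2 ^ Suc n"
      using scaled_pow2_le[of t n] by simp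
    also have "\<dots> < real (scaled_pow2 t (Suc n)) + 1"
      by (rule scaled_pow2_gt)
    finally show ?thesis
      using scaled_pow2_ge_1[OF assms, of n] by linarith
  qed
  then show ?thesis
    by (simp add: strict_mono_Suc_iff)
qed

text \<open>If \<open>n\<close> and \<open>n + d\<close> are in \<open>S\<close> and
  \<open>N n = m k\<close>, then \<open>m (Suc k)\<close> is at most \<open>N (n + d)\<close>, so
  the ratio at \<open>k\<close> is at most \<open>2 ^ (d + 1)\<close>. Only finitely many
  \<open>k\<close> allow this.\<close>

lemma lacunary_imp_spread:
  assumes t: "t \<ge> 0" and m: "strict_mono m"
    and ev: "eventually (\<lambda>x. x \<in> range m) (pow2_ultrafilter \<eta> t)"
    and lim: "filterlim (\<lambda>k. real (m (Suc k)) / real (m k)) at_top sequentially"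
  shows "\<exists>S. spread S \<and> eventually (\<lambda>n. n \<in> S) \<eta>"
proof -
  define N where "N = scaled_pow2 t"
  have N1: "1 \<le> N n" and Nle: "real (N n) \<le> 2 powr t * 2 ^ n"
    and Ngt: "2 powr t * 2 ^ n < real (N n) + 1" and N: "strict_mono N" for n
    using t by (simp_all add: N_def scaled_pow2_ge_1[simplified] scaled_pow2_le scaled_pow2_gt
        strict_mono_scaled_pow2)
  define S where "S = {n. N n \<in> range m}"
  have "finite {n \<in> S. n + d \<in> S}" if d: "d > 0" for d
  proof -
    let ?K = "{k. \<not> 2 ^ Suc d < real (m (Suc k)) / real (m k)}"
    have "eventually (\<lambda>k. 2 ^ Suc d < real (m (Suc k)) / real (m k)) sequentially"
      using lim by (auto simp: filterlim_at_top_dense)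
    then have "finite ?K"
      by (simp add: cofinite_eq_sequentially[symmetric] eventually_cofinite)
    then have "finite (N -` m ` ?K)"
      using strict_mono_imp_inj_on[OF N] by (intro finite_vimageI finite_imageI)
    moreover have "{n \<in> S. n + d \<in> S} \<subseteq> N -` m ` ?K"
    proof
      fix n assume "n \<in> {n \<in> S. n + d \<in> S}"
      then obtain k l where kl: "N n = m k" "N (n + d) = m l"
        by (auto simp: S_def)
      have "m k < m l"
        using N d kl by (metis less_add_same_cancel1 strict_mono_less)
      then have "Suc k \<le> l"
        using m by (simp add: strict_mono_less Suc_le_eq)
      then have "m (Suc k) \<le> N (n + d)"
        using m kl(2) by (simp add: strict_mono_less_eq)
      then have "real (m (Suc k)) \<le> 2 ^ d * (2 powr t * 2 ^ n)"
        using Nle[of "n + d"] by (simp add: power_add algebra_simps)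
      \<comment> \<open>The factor 2 pays for the floor:
        \<open>\<theta> 2 ^ n < N n + 1 \<le> 2 * N n\<close>.\<close>
      also have "\<dots> \<le> 2 ^ d * (2 * real (m k))"
        using Ngt[of n] N1[of n] kl(1) by (intro mult_left_mono) auto
      finally have "real (m (Suc k)) / real (m k) \<le> 2 ^ Suc d"
        using N1[of n] kl(1) by (simp add: divide_le_eq)
      then have "k \<in> ?K" by simp
      then show "n \<in> N -` m ` ?K"
        using kl(1) by auto
    qed
    ultimately show ?thesis
      by (rule finite_subset[rotated])
  qed
  moreover have "eventually (\<lambda>n. n \<in> S) \<eta>"
    using ev by (simp add: pow2_ultrafilter_def eventually_filtermap S_def N_def scaled_pow2_def)
  ultimately show ?thesis
    unfolding spread_def by blast
qed

lemma spread_imp_lacunary: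
  assumes \<eta>: "\<eta> \<in> Nstar" and t: "t \<ge> 0" and S: "spread S" "eventually (\<lambda>n. n \<in> S) \<eta>"
  shows "\<exists>m. strict_mono m \<and> eventually (\<lambda>x. x \<in> range m) (pow2_ultrafilter \<eta> t) \<and>
    filterlim (\<lambda>k. real (m (Suc k)) / real (m k)) at_top sequentially"
proof -
  define N where "N = scaled_pow2 t"
  have N1: "1 \<le> N n" and Nle: "real (N n) \<le> 2 powr t * 2 ^ n"
    and Ngt: "2 powr t * 2 ^ n < real (N n) + 1" and N: "strict_mono N" for n
    using t by (simp_all add: N_def scaled_pow2_ge_1[simplified] scaled_pow2_le scaled_pow2_gt
        strict_mono_scaled_pow2)
  have inf: "infinite S"
    by (rule Nstar_eventually_infinite[OF \<eta> S(2)])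
  define e where "e = enumerate S"
  have e: "strict_mono e" "range e = S"
    using inf by (simp_all add: e_def strict_mono_enumerate range_enumerate)
  have gap: "eventually (\<lambda>k. e k + d < e (Suc k)) sequentially" for d
  proof -
    \<comment> \<open>A gap of at most \<open>d\<close> after \<open>e k\<close> puts
      \<open>e k\<close> into one of these finitely many finite sets.\<close>
    let ?R = "\<Union>c\<in>{1..d}. {n \<in> S. n + c \<in> S}"
    have "finite ?R"
      using S(1) by (auto simp: spread_def)
    then have "finite (e -` ?R)"
      using strict_mono_imp_inj_on[OF e(1)] by (rule finite_vimageI)
    then have "eventually (\<lambda>k. k \<notin> e -` ?R) sequentially"
      unfolding cofinite_eq_sequentially[symmetric] eventually_cofinite not_not Collect_mem_eq .
    then show ?thesis
    proof eventually_elim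
      case (elim k)
      show ?case
      proof (rule ccontr)
        assume le: "\<not> e k + d < e (Suc k)"
        have "e k < e (Suc k)"
          using e(1) by (simp add: strict_mono_less)
        then have "e (Suc k) - e k \<in> {1..d}" "e k + (e (Suc k) - e k) = e (Suc k)"
          using le by auto
        moreover have "e k \<in> S" "e (Suc k) \<in> S"
          using e(2) by auto
        ultimately show False
          using elim by (metis (mono_tags, lifting) UN_iff mem_Collect_eq vimageI2)
      qed
    qed
  qed
  \<comment> \<open>The strict gap provides the extra 1 that absorbs the floor, as
    \<open>N (e k + d) + 1 \<le> N (e (Suc k))\<close>.\<close>
  have ratio: "2 ^ d \<le> real (N (e (Suc k))) / real (N (e k))" if "e k + d < e (Suc k)" for d k
  proof -
    have "2 ^ d * real (N (e k)) \<le> 2 ^ d * (2 powr t * 2 ^ e k)"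
      by (intro mult_left_mono Nle) simp
    also have "\<dots> = 2 powr t * 2 ^ (e k + d)"
      by (simp add: power_add)
    also have "\<dots> < real (N (e k + d)) + 1"
      by (rule Ngt)
    also have "\<dots> \<le> real (N (e (Suc k)))"
      using strict_monoD[OF N that] by linarith
    finally show ?thesis
      using N1[of "e k"] by (simp add: le_divide_eq)
  qed
  have "filterlim (\<lambda>k. real (N (e (Suc k))) / real (N (e k))) at_top sequentially"
    unfolding filterlim_at_top
  proof
    fix Z :: real
    obtain d where d: "Z < 2 ^ d"
      using real_arch_pow[of 2 Z] by auto
    show "eventually (\<lambda>k. Z \<le> real (N (e (Suc k))) / real (N (e k))) sequentially"
      using gap[of d]
    proof eventually_elim
      case (elim k)
      show ?case
        using ratio[OF elim] d by linarith
    qed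
  qed
  moreover have "strict_mono (\<lambda>k. N (e k))"
    using N e(1) by (simp add: strict_mono_def)
  moreover have "eventually (\<lambda>x. x \<in> range (\<lambda>k. N (e k))) (pow2_ultrafilter \<eta> t)"
    unfolding pow2_ultrafilter_def eventually_filtermap
    using S(2) by eventually_elim (use e(2) in \<open>auto simp: N_def scaled_pow2_def[symmetric]\<close>)
  ultimately show ?thesis
    by (intro exI[of _ "\<lambda>k. N (e k)"]) simp
qed

section \<open>The additive property\<close>

lemma spread_imp_additive:
  assumes \<eta>: "\<eta> \<in> Nstar" and S: "spread S" "eventually (\<lambda>n. n \<in> S) \<eta>"
  shows "additive_property (nu \<eta> t)"
  unfolding additive_property_def
proof (intro allI impI)
  fix A :: "nat \<Rightarrow> nat set" assume A: "incseq A"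
  define D where "D C n = real (card (C \<inter> {1..scaled_pow2 t n})) / (2 powr t * 2 ^ n)" for C n
  have nt: "\<eta> \<noteq> bot"
    using \<eta> by (simp add: Nstar_iff ultrafilter_def)
  have D_nu: "(D C \<longlongrightarrow> nu \<eta> t C) \<eta>" for C
    using nu_tendsto[OF \<eta>, of C t] by (simp add: D_def[abs_def] scaled_pow2_def)
  have D_bounds: "0 \<le> D C n" "D C n \<le> 1" for C n
  proof -
    have "card (C \<inter> {1..scaled_pow2 t n}) \<le> scaled_pow2 t n"
      using card_mono[of "{1..scaled_pow2 t n}" "C \<inter> {1..scaled_pow2 t n}"] by simp
    then show "0 \<le> D C n" "D C n \<le> 1"
      using scaled_pow2_le[of t n] by (auto simp: D_def divide_le_eq)
  qed
  have D_mono: "D C n \<le> D C' n" if "C \<inter> {1..scaled_pow2 t n} \<subseteq> C'" for C C' n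
    using that by (auto simp: D_def intro!: divide_right_mono card_mono)
  have nu_mono: "nu \<eta> t C \<le> nu \<eta> t C'" if "C \<subseteq> C'" for C C'
    using that by (intro tendsto_le[OF nt D_nu D_nu] always_eventually allI D_mono) auto
  have "nu \<eta> t C \<le> 1" for C
    using D_nu D_bounds nt by (intro tendsto_upperbound[OF D_nu]) auto
  then obtain \<alpha> where \<alpha>: "(\<lambda>j. nu \<eta> t (A j)) \<longlonglongrightarrow> \<alpha>" "\<And>j. nu \<eta> t (A j) \<le> \<alpha>"
    using incseq_convergent[of "\<lambda>j. nu \<eta> t (A j)" 1] A nu_mono by (metis incseq_def)

  \<comment> \<open>\<open>idx x\<close> labels the block of \<open>x\<close>: for \<open>n\<close>
    in \<open>S\<close> it equals \<open>n\<close> exactly on \<open>(N n', N n]\<close>, where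
    \<open>n'\<close> is the predecessor of \<open>n\<close> in \<open>S\<close>. So
    \<open>E n\<close> is what lies in the earlier blocks.\<close>
  define idx where "idx x = (LEAST n. n \<in> S \<and> x \<le> scaled_pow2 t n)" for x
  define E where "E n = {x \<in> {1..scaled_pow2 t n}. idx x \<noteq> n}" for n
  have idx: "idx x \<in> S \<and> x \<le> scaled_pow2 t (idx x)" "idx x \<le> n"
    if "n \<in> S" "x \<le> scaled_pow2 t n" for x n
    using that unfolding idx_def by (auto intro: LeastI2 Least_le)
  \<comment> \<open>As \<open>S\<close> is spread, all but a negligible part of \<open>[1, [\<theta> 2 ^ n]]\<close> has index \<open>n\<close>.\<close>
  have E_lim: "((\<lambda>n. D (E n) n) \<longlongrightarrow> 0) \<eta>"
  proof (rule tendstoI)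
    fix \<epsilon> :: real assume "\<epsilon> > 0"
    then obtain d where d: "(1 / 2) ^ d < \<epsilon>"
      using real_arch_pow_inv[of \<epsilon> "1 / 2"] by auto
    \<comment> \<open>Outside this finite set no element of \<open>S\<close> lies within distance
      \<open>d\<close> below \<open>n\<close>, so \<open>E n\<close> stays below
      \<open>N (n - d)\<close> and has density at most \<open>2 ^ -d\<close>. Discarding
      \<open>n < d\<close> as well keeps the truncated subtraction honest.\<close>
    have "finite (\<Union>c\<in>{1..d}. (\<lambda>n. n + c) ` {n \<in> S. n + c \<in> S})"
      using S(1) by (auto simp: spread_def)
    from Nstar_finite[OF \<eta> this] Nstar_finite[OF \<eta> finite_lessThan[of d]] S(2)
    show "eventually (\<lambda>n. dist (D (E n) n) 0 < \<epsilon>) \<eta>"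
    proof eventually_elim
      case (elim n)
      have "E n \<subseteq> {1..scaled_pow2 t (n - d)}"
      proof
        fix x assume x: "x \<in> E n"
        define i where "i = idx x"
        have i: "i \<in> S" "x \<le> scaled_pow2 t i" "i < n"
          using idx[OF elim(3), of x] x by (auto simp: E_def i_def)
        have "n - i \<notin> {1..d}"
        proof
          assume c: "n - i \<in> {1..d}"
          have "i \<in> {k \<in> S. k + (n - i) \<in> S}" "n = i + (n - i)"
            using i elim(3) by auto
          then show False
            using elim(1) c by blast
        qed
        then have "i \<le> n - d"
          using i(3) by auto
        then have "x \<le> scaled_pow2 t (n - d)"
          using i(2) scaled_pow2_mono order_trans by blast
        then show "x \<in> {1..scaled_pow2 t (n - d)}"
          using x by (auto simp: E_def)
      qed
      then have "card (E n \<inter> {1..scaled_pow2 t n}) \<le> scaled_pow2 t (n - d)"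
        using card_mono[of "{1..scaled_pow2 t (n - d)}" "E n \<inter> {1..scaled_pow2 t n}"] by auto
      then have "real (card (E n \<inter> {1..scaled_pow2 t n})) \<le> 2 powr t * 2 ^ (n - d)"
        using scaled_pow2_le[of t "n - d"] by linarith
      also have "\<dots> = (1 / 2) ^ d * (2 powr t * 2 ^ n)"
        using elim(2) by (simp add: power_diff power_divide)
      finally have "D (E n) n \<le> (1 / 2) ^ d"
        by (simp add: D_def divide_le_eq)
      then show ?case
        using d D_bounds(1)[of "E n" n] by simp
    qed
  qed

  define Q where "Q n = {j. j \<le> n \<and> (j = 0 \<or> D (A j) n \<le> \<alpha> + inverse (real (Suc j)))}" for n
  define J where "J n = Max (Q n)" for n
  have Q: "finite (Q n)" "Q n \<noteq> {}" for n
    by (auto simp: Q_def intro: exI[of _ 0])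
  have J_ge: "eventually (\<lambda>n. j \<le> J n) \<eta>" for j
  proof -
    have "nu \<eta> t (A j) < \<alpha> + inverse (real (Suc j))"
      using \<alpha>(2)[of j] by (smt (verit) inverse_positive_iff_positive of_nat_0_less_iff zero_less_Suc)
    from order_tendstoD(2)[OF D_nu this] Nstar_finite[OF \<eta> finite_lessThan[of j]]
    show ?thesis
      by eventually_elim (auto simp: J_def Q_def[symmetric] intro!: Max_ge Q, auto simp: Q_def)
  qed
  have DJ_le: "D (A (J n)) n \<le> \<alpha> + inverse (real (Suc (J n)))" if "J n > 0" for n
    using Max_in[OF Q(1) Q(2), of n] that by (simp add: J_def[symmetric]) (simp add: Q_def)
  \<comment> \<open>From below, \<open>A (J n)\<close> eventually contains any fixed
    \<open>A j\<close>, whose measure can be chosen close to \<open>\<alpha>\<close>; from above,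
    the slack in \<open>Q\<close> shrinks as \<open>J n\<close> grows.\<close>
  have DJ: "((\<lambda>n. D (A (J n)) n) \<longlongrightarrow> \<alpha>) \<eta>"
  proof (rule order_tendstoI)
    fix a assume "a < \<alpha>"
    then obtain j where "a < nu \<eta> t (A j)"
      using order_tendstoD(1)[OF \<alpha>(1)] eventually_happens'[OF sequentially_bot] by blast
    from order_tendstoD(1)[OF D_nu this] J_ge[of j]
    show "eventually (\<lambda>n. a < D (A (J n)) n) \<eta>"
    proof eventually_elim
      case (elim n)
      have "A j \<subseteq> A (J n)"
        using A elim(2) by (simp add: incseq_def)
      then show ?case
        using elim(1) D_mono[of "A j" n "A (J n)"] by force
    qed
  next
    fix a assume "\<alpha> < a"
    then obtain j where j: "inverse (real (Suc j)) < a - \<alpha>"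
      using reals_Archimedean[of "a - \<alpha>"] by auto
    show "eventually (\<lambda>n. D (A (J n)) n < a) \<eta>"
      using J_ge[of "Suc j"]
    proof eventually_elim
      case (elim n)
      then have "inverse (real (Suc (J n))) \<le> inverse (real (Suc j))"
        by (intro le_imp_inverse_le) auto
      then show ?case
        using DJ_le[of n] elim j by linarith
    qed
  qed

  define B where "B = {x. x \<in> A (J (idx x))}"
  have D_Un: "D (C \<union> C') n \<le> D C n + D C' n" for C C' n
    unfolding D_def add_divide_distrib[symmetric] Int_Un_distrib2
    by (intro divide_right_mono) (simp_all add: card_Un_le flip: of_nat_add)
  have idx_E: "idx x = n" if "x \<in> {1..scaled_pow2 t n}" "x \<notin> E n" for x n
    using that by (simp add: E_def)
  \<comment> \<open>Off \<open>E n\<close> every point of \<open>{1..N n}\<close> has index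
    \<open>n\<close>, so \<open>B\<close> and \<open>A (J n)\<close> coincide there.\<close>
  have close: "\<bar>D B n - D (A (J n)) n\<bar> \<le> D (E n) n" for n
  proof -
    have "D B n \<le> D (A (J n) \<union> E n) n" "D (A (J n)) n \<le> D (B \<union> E n) n"
      using idx_E by (auto intro!: D_mono simp: B_def)
    then show ?thesis
      using D_Un[of "A (J n)" "E n" n] D_Un[of B "E n" n] by linarith
  qed
  have "((\<lambda>n. D B n - D (A (J n)) n) \<longlongrightarrow> 0) \<eta>"
    by (rule Lim_null_comparison[OF _ E_lim]) (simp add: close)
  from tendsto_add[OF this DJ] have "(D B \<longlongrightarrow> \<alpha>) \<eta>"
    by simp
  then have "nu \<eta> t B = \<alpha>"
    using tendsto_unique[OF nt D_nu] by blast
  \<comment> \<open>Once \<open>J n \<ge> j\<close>, the set \<open>A j\<close> is contained in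
    \<open>A (J n)\<close>, so up to \<open>N n\<close> it can leave \<open>B\<close> only inside
    \<open>E n\<close>.\<close>
  moreover have "nu \<eta> t (A j - B) = 0" for j
  proof (rule tendsto_unique[OF nt D_nu])
    have "eventually (\<lambda>n. norm (D (A j - B) n) \<le> D (E n) n) \<eta>"
      using J_ge[of j]
    proof eventually_elim
      case (elim n)
      then have "A j \<subseteq> A (J n)"
        using A by (simp add: incseq_def)
      then have "D (A j - B) n \<le> D (E n) n"
        using idx_E[of _ n] by (intro D_mono) (force simp: B_def)
      then show ?case
        using D_bounds(1)[of "A j - B" n] by simp
    qed
    then show "(D (A j - B) \<longlongrightarrow> 0) \<eta>"
      by (rule Lim_null_comparison[OF _ E_lim])
  qed
  ultimately show "\<exists>B. (\<lambda>k. nu \<eta> t (A k)) \<longlonglongrightarrow> nu \<eta> t B \<and> (\<forall>k. nu \<eta> t (A k - B) = 0)"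
    using \<alpha>(1) by blast
qed

theorem theorem5p2:
  fixes \<omega> :: "(nat filter \<times> real) set" and \<eta> :: "nat filter" and t :: real
  assumes "\<omega> \<in> Omega_star" and "(\<eta>, t) \<in> \<omega>"
  shows "(additive_property (nu \<eta> t) \<and>
          (\<exists>m :: nat \<Rightarrow> nat. strict_mono m \<and>
             eventually (\<lambda>x. x \<in> range m) (pow2_ultrafilter \<eta> t) \<and>
             filterlim (\<lambda>k. real (m (Suc k)) / real (m k)) at_top sequentially))
         \<longleftrightarrow> \<omega> \<in> wandering"
proof
  have \<eta>: "\<eta> \<in> Nstar" and t: "t \<ge> 0"
    using Omega_star_rep[OF assms] by auto
  {
    assume "additive_property (nu \<eta> t) \<and>
          (\<exists>m :: nat \<Rightarrow> nat. strict_mono m \<and>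
             eventually (\<lambda>x. x \<in> range m) (pow2_ultrafilter \<eta> t) \<and>
             filterlim (\<lambda>k. real (m (Suc k)) / real (m k)) at_top sequentially)"
    then show "\<omega> \<in> wandering"
      using lacunary_imp_spread[OF t] spread_imp_wandering[OF assms] by blast
  next
    assume "\<omega> \<in> wandering"
    then obtain S where "spread S" "eventually (\<lambda>n. n \<in> S) \<eta>"
      using wandering_imp_spread assms(2) by blast
    then show "additive_property (nu \<eta> t) \<and>
          (\<exists>m :: nat \<Rightarrow> nat. strict_mono m \<and>
             eventually (\<lambda>x. x \<in> range m) (pow2_ultrafilter \<eta> t) \<and>
             filterlim (\<lambda>k. real (m (Suc k)) / real (m k)) at_top sequentially)"
      using spread_imp_additive[OF \<eta>] spread_imp_lacunary[OF \<eta> t] by blast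
  }
qed

end
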